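(* Let $k\in[0,1)$ and $L\in[0,1)$. No deterministic strategyproof mechanism can achieve an approximation ratio lower than $g_m$ for the maximum cost, where $$g_m=\min_{a\in[0,1-L]}\max\left(\frac{a+k(1-a)}{\frac a2+k\left(1-\frac a2\right)},\; 2\cdot\frac{\max(a,1-L-a)+k(1-a)}{1-L+k(1+L)}\right).$$ Moreover, the minimum is attained at $$a_0=\frac{-k[(1-k)L+2(1+k)]+\sqrt{k^2[(1-k)L+2(1+k)]^2+4(1+k)(1-k)k[(1+k)(1-L)]}}{2(1+k)(1-k)}.$$ When $L=0$, the lower bound is $g_m=\frac{2}{1+\sqrt k}$. (For $k=0$ and $a=0$ the first quotient, which has the form $0/0$, is read as its limit $2$ as $a\to0^+$.)
   Context: Setting. Fix a constant $k\in[0,1)$ and an obstacle length $L\in[0,1)$. An instance consists of an obstacle $[o,o+L]$ with $o\in(0,1)$, $L<1-o$, and a profile $\mathbf x=(x_1,\ldots,x_n)$ of agent locations $x_i\in[0,o)\cup(o+L,1]$; $N=\{1,\ldots,n\}$, $N_1=\{i: x_i<o\}$, $N_2=\{i: x_i>o+L\}$. An edge is a pair $(a,b)$ with $a\in[0,o)$, $b\in(o+L,1]$. The cost of agent $i\in N_1$ is $cost(a,b,x_i)=|x_i-a|+k(b-a)+(1-b)$; the cost of agent $i\in N_2$ is $cost(a,b,x_i)=|x_i-b|+k(b-a)+a$. The maximum cost is $MC(a,b,\mathbf x)=\max_{i\in N}cost(a,b,x_i)$. The obstacle is publicly known; a deterministic mechanism assigns, for every obstacle position $o$ and every number of agents,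 an edge $f(\mathbf x)$ to each location profile. It is strategyproof if for every agent $i$, every $\mathbf x$ and every $x_i'$ in the same region as $x_i$, $cost(f(x_i,\mathbf x_{-i}),x_i)\le cost(f(x_i',\mathbf x_{-i}),x_i)$. It has approximation ratio $\alpha\ge1$ for the maximum cost if $MC(f(\mathbf x),\mathbf x)\le\alpha\cdot\min_{(a,b)}MC(a,b,\mathbf x)$ (minimum over all edges) for all instances, including all obstacle positions $o$. As a standing convention only anonymous mechanisms (outcome invariant under permutations of the agents) are considered. *)

theory Defs
  imports Complex_Main "HOL-Library.Multiset"
begin

text \<open>
  The obstacle is the interval from \<open>p\<close> to \<open>p + L\<close>. A location profile of \<open>n\<close> agents is a
  list of length \<open>n\<close>.
\<close>

definition obstacle_pos :: "real \<Rightarrow> real \<Rightarrow> bool" where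
  "obstacle_pos L p \<longleftrightarrow> 0 < p \<and> p < 1 \<and> L < 1 - p"

definition left_region :: "real \<Rightarrow> real set" where
  "left_region p = {0..<p}"

definition right_region :: "real \<Rightarrow> real \<Rightarrow> real set" where
  "right_region L p = {p + L<..1}"

definition edges :: "real \<Rightarrow> real \<Rightarrow> (real \<times> real) set" where
  "edges L p = left_region p \<times> right_region L p"

definition profile :: "real \<Rightarrow> real \<Rightarrow> real list \<Rightarrow> bool" where
  "profile L p xs \<longleftrightarrow> xs \<noteq> [] \<and> set xs \<subseteq> left_region p \<union> right_region L p"

text \<open>
  Only used for agent locations \<open>x\<close> in one of the two regions, so the else-branch is the case
  of an agent to the right of the obstacle.
\<close>

definition cost :: "real \<Rightarrow> real \<Rightarrow> real \<times> real \<Rightarrow> real \<Rightarrow> real" where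
  "cost k p = (\<lambda>(a, b) x.
     if x < p then \<bar>x - a\<bar> + k * (b - a) + (1 - b)
     else \<bar>x - b\<bar> + k * (b - a) + a)"

definition MC :: "real \<Rightarrow> real \<Rightarrow> real \<times> real \<Rightarrow> real list \<Rightarrow> real" where
  "MC k p e xs = Max (cost k p e ` set xs)"

text \<open>
  For \<open>0 \<le> k < 1\<close> this infimum is a minimum even though the edge set is half-open: moving \<open>a\<close>
  to the right of all left agents (and of \<open>0\<close>), or \<open>b\<close> to the left of all right agents
  (and of \<open>1\<close>), only increases every agent's cost.
\<close>

definition opt_MC :: "real \<Rightarrow> real \<Rightarrow> real \<Rightarrow> real list \<Rightarrow> real" where
  "opt_MC k L p xs = (INF e\<in>edges L p. MC k p e xs)"

text \<open>
  A mechanism takes the (public) obstacle position and a profile with any number of agents.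
\<close>

type_synonym mechanism = "real \<Rightarrow> real list \<Rightarrow> real \<times> real"

definition is_mechanism :: "real \<Rightarrow> mechanism \<Rightarrow> bool" where
  "is_mechanism L f \<longleftrightarrow>
     (\<forall>p xs. obstacle_pos L p \<longrightarrow> profile L p xs \<longrightarrow> f p xs \<in> edges L p)"

definition anonymous :: "real \<Rightarrow> mechanism \<Rightarrow> bool" where
  "anonymous L f \<longleftrightarrow>
     (\<forall>p xs ys. obstacle_pos L p \<longrightarrow> profile L p xs \<longrightarrow> mset ys = mset xs \<longrightarrow> f p ys = f p xs)"

definition same_region :: "real \<Rightarrow> real \<Rightarrow> real \<Rightarrow> real \<Rightarrow> bool" where
  "same_region L p x y \<longleftrightarrow>
     x \<in> left_region p \<and> y \<in> left_region p \<or> x \<in> right_region L p \<and> y \<in> right_region L p"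

definition strategyproof :: "real \<Rightarrow> real \<Rightarrow> mechanism \<Rightarrow> bool" where
  "strategyproof k L f \<longleftrightarrow>
     (\<forall>p xs i x'. obstacle_pos L p \<longrightarrow> profile L p xs \<longrightarrow> i < length xs \<longrightarrow>
        same_region L p (xs ! i) x' \<longrightarrow>
        cost k p (f p xs) (xs ! i) \<le> cost k p (f p (xs[i := x'])) (xs ! i))"

definition approx_ratio :: "real \<Rightarrow> real \<Rightarrow> mechanism \<Rightarrow> real \<Rightarrow> bool" where
  "approx_ratio k L f \<alpha> \<longleftrightarrow> \<alpha> \<ge> 1 \<and>
     (\<forall>p xs. obstacle_pos L p \<longrightarrow> profile L p xs \<longrightarrow>
        MC k p (f p xs) xs \<le> \<alpha> * opt_MC k L p xs)"

text \<open>
  At \<open>k = a = 0\<close> the first quotient has the form \<open>0/0\<close>; its value there is the limit \<open>2\<close> for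
  \<open>a\<close> tending to \<open>0\<close> from the right.
\<close>

definition quotient1 :: "real \<Rightarrow> real \<Rightarrow> real" where
  "quotient1 k a =
     (if k = 0 \<and> a = 0 then 2 else (a + k * (1 - a)) / (a / 2 + k * (1 - a / 2)))"

definition quotient2 :: "real \<Rightarrow> real \<Rightarrow> real \<Rightarrow> real" where
  "quotient2 k L a = 2 * ((max a (1 - L - a) + k * (1 - a)) / (1 - L + k * (1 + L)))"

definition bound_fun :: "real \<Rightarrow> real \<Rightarrow> real \<Rightarrow> real" where
  "bound_fun k L a = max (quotient1 k a) (quotient2 k L a)"

definition g_m :: "real \<Rightarrow> real \<Rightarrow> real" where
  "g_m k L = (INF a\<in>{0..1 - L}. bound_fun k L a)"

definition a0 :: "real \<Rightarrow> real \<Rightarrow> real" where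
  "a0 k L =
     (- k * ((1 - k) * L + 2 * (1 + k))
       + sqrt (k\<^sup>2 * ((1 - k) * L + 2 * (1 + k))\<^sup>2
               + 4 * (1 + k) * (1 - k) * k * ((1 + k) * (1 - L))))
     / (2 * (1 + k) * (1 - k))"

end

theory Submission
  imports Defs
begin

text \<open>
  Put the obstacle almost at the right end of the unit interval, so that \<open>b\<close> is forced to be
  close to \<open>1\<close>, and place one agent at \<open>0\<close> and one just left of the obstacle. If the mechanism
  answers with left endpoint \<open>a\<close>, its ratio is about \<open>quotient2 k L a\<close>. When the second agent is
  located at \<open>a\<close> instead, strategyproofness forces the left endpoint to stay close to \<open>a\<close>, and the
  ratio is about \<open>quotient1 k a\<close>. The first quotient increases in \<open>a\<close>, the second one decreases up
  to \<open>(1 - L) / 2\<close>, and \<open>a0\<close> is the root of the quadratic equation at which they agree.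
\<close>

section \<open>The minimum of the bound\<close>

lemma quotient1_pos_k:
  assumes "0 < k"
  shows "quotient1 k a = 2 * (k + (1 - k) * a) / (2 * k + (1 - k) * a)"
proof -
  have "quotient1 k a = (k + (1 - k) * a) / ((2 * k + (1 - k) * a) / 2)"
    using assms by (simp add: quotient1_def field_simps)
  then show ?thesis
    by simp
qed

text \<open>With \<open>t = (1 - k) * a\<close> the quotient is
  \<open>2 - 2 * k / (2 * k + t)\<close>, which increases in \<open>t\<close>.\<close>

lemma quotient1_mono:
  assumes "0 < k" "k < 1" "0 \<le> a" "a \<le> b"
  shows "quotient1 k a \<le> quotient1 k b"
proof -
  have "(1 - k) * a \<le> (1 - k) * b" "0 \<le> (1 - k) * a"
    using assms by (auto intro: mult_left_mono)
  then have "(2 * (k + (1 - k) * a)) * (2 * k + (1 - k) * b)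
      \<le> (2 * (k + (1 - k) * b)) * (2 * k + (1 - k) * a)"
    using assms mult_left_mono[of "(1 - k) * a" "(1 - k) * b" k]
    by (simp add: algebra_simps)
  then show ?thesis
    using assms \<open>0 \<le> (1 - k) * a\<close> \<open>(1 - k) * a \<le> (1 - k) * b\<close>
    by (simp add: quotient1_pos_k[OF assms(1)] pos_divide_le_eq pos_le_divide_eq add_pos_nonneg)
qed

lemma quotient1_zero_k: "0 \<le> a \<Longrightarrow> quotient1 0 a = 2"
  by (simp add: quotient1_def)

lemma quotient2_denom_pos:
  fixes k L :: real
  assumes "0 \<le> k" "0 \<le> L" "L < 1"
  shows "0 < 1 - L + k * (1 + L)"
  using assms by (intro add_pos_nonneg) auto

text \<open>Up to the midpoint \<open>(1 - L) / 2\<close> the maximum is \<open>1 - L - a\<close>,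
  so both summands of the numerator decrease in \<open>a\<close>.\<close>

lemma quotient2_antimono:
  assumes "0 \<le> k" "0 \<le> L" "L < 1" "a \<le> b" "b \<le> (1 - L) / 2"
  shows "quotient2 k L b \<le> quotient2 k L a"
proof -
  have "k * (1 - b) \<le> k * (1 - a)"
    using assms by (intro mult_left_mono) auto
  then have "max b (1 - L - b) + k * (1 - b) \<le> max a (1 - L - a) + k * (1 - a)"
    using assms by (simp add: max_def)
  then show ?thesis
    unfolding quotient2_def using quotient2_denom_pos[of k L] assms
    by (intro mult_left_mono divide_right_mono) auto
qed

text \<open>Difference of the cross products when the two quotients are equated, with the maximum in
  \<open>quotient2\<close> resolved to \<open>1 - L - a\<close>.\<close>

definition crossing_poly :: "real \<Rightarrow> real \<Rightarrow> real \<Rightarrow> real" where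
  "crossing_poly k L a = (1 + k) * (1 - k) * a\<^sup>2 + k * ((1 - k) * L + 2 * (1 + k)) * a
     - k * (1 + k) * (1 - L)"

lemma a0_nonneg:
  assumes "0 \<le> k" "k < 1" "0 \<le> L" "L < 1"
  shows "0 \<le> a0 k L"
proof -
  define B where "B = k * ((1 - k) * L + 2 * (1 + k))"
  define C where "C = 4 * (1 + k) * (1 - k) * k * ((1 + k) * (1 - L))"
  have "0 \<le> B" "0 \<le> C"
    using assms by (auto simp: B_def C_def)
  then have "B \<le> sqrt (B\<^sup>2 + C)"
    by (intro real_le_rsqrt) auto
  moreover have "a0 k L = (- B + sqrt (B\<^sup>2 + C)) / (2 * (1 + k) * (1 - k))"
    by (simp add: a0_def B_def C_def power_mult_distrib)
  ultimately show ?thesis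
    using assms by simp
qed

text \<open>Completing the square: \<open>4 * A\<close> times the polynomial is
  \<open>(2 * A * a + B)\<^sup>2 - (B\<^sup>2 + 4 * A * C)\<close>.\<close>

lemma crossing_poly_a0:
  assumes "0 \<le> k" "k < 1" "0 \<le> L" "L < 1"
  shows "crossing_poly k L (a0 k L) = 0"
proof -
  define A where "A = (1 + k) * (1 - k)"
  define B where "B = k * ((1 - k) * L + 2 * (1 + k))"
  define C where "C = k * (1 + k) * (1 - L)"
  have A: "0 < A" and C: "0 \<le> C"
    using assms by (auto simp: A_def C_def)
  have "a0 k L = (- B + sqrt (B\<^sup>2 + 4 * A * C)) / (2 * A)"
    by (simp add: a0_def A_def B_def C_def power_mult_distrib mult.assoc del: distrib_left_numeral)
  then have "2 * A * a0 k L + B = sqrt (B\<^sup>2 + 4 * A * C)"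
    using A by simp
  then have "(2 * A * a0 k L + B)\<^sup>2 = B\<^sup>2 + 4 * A * C"
    using A C by simp
  then have "4 * A * (A * (a0 k L)\<^sup>2 + B * a0 k L - C) = 0"
    by (simp add: power2_eq_square algebra_simps)
  then have "A * (a0 k L)\<^sup>2 + B * a0 k L - C = 0"
    using A by simp
  then show ?thesis
    unfolding crossing_poly_def A_def B_def C_def .
qed

text \<open>Ensures that the maximum in \<open>quotient2\<close> at \<open>a0\<close> is
  \<open>1 - L - a0\<close>. The polynomial is monotone on nonnegative arguments, vanishes at
  \<open>a0\<close>, and is already positive at the midpoint.\<close>

lemma a0_le_half:
  assumes "0 \<le> k" "k < 1" "0 \<le> L" "L < 1"
  shows "a0 k L \<le> (1 - L) / 2"
proof (rule ccontr)
  define h where "h = (1 - L) / 2"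
  assume "\<not> a0 k L \<le> (1 - L) / 2"
  then have h: "0 < h" "h < a0 k L"
    using assms by (auto simp: h_def)
  \<comment> \<open>Since \<open>1 - L = 2 * h\<close>, the constant term cancels the part
    \<open>2 * k * (1 + k) * h\<close> of the linear term.\<close>
  have "crossing_poly k L h = (1 - k) * h * ((1 + k) * h + k * L)"
    unfolding crossing_poly_def h_def by (simp add: field_simps power2_eq_square)
  then have "0 < crossing_poly k L h"
    using assms h by (simp add: add_pos_nonneg)
  moreover have "crossing_poly k L h \<le> crossing_poly k L (a0 k L)"
    unfolding crossing_poly_def using assms h
    by (intro diff_right_mono add_mono mult_left_mono power_mono) auto
  ultimately show False
    using crossing_poly_a0 assms by simp
qed

lemma quotients_agree_at_a0:
  assumes "0 < k" "k < 1" "0 \<le> L" "L < 1"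
  shows "quotient1 k (a0 k L) = quotient2 k L (a0 k L)"
proof -
  define a where "a = a0 k L"
  have a: "0 \<le> a" "a \<le> (1 - L) / 2"
    using a0_nonneg a0_le_half assms by (auto simp: a_def)
  have p: "0 < 2 * k + (1 - k) * a"
    using assms a by (intro add_pos_nonneg) auto
  have d: "0 < 1 - L + k * (1 + L)"
    using quotient2_denom_pos assms by auto
  have "(k + (1 - k) * a) * (1 - L + k * (1 + L))
      - (1 - L - a + k * (1 - a)) * (2 * k + (1 - k) * a) = crossing_poly k L a"
    by (simp add: crossing_poly_def algebra_simps power2_eq_square)
  also have "\<dots> = 0"
    using crossing_poly_a0 assms by (simp add: a_def)
  finally have "(k + (1 - k) * a) / (2 * k + (1 - k) * a)
      = (1 - L - a + k * (1 - a)) / (1 - L + k * (1 + L))"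
    using p d by (subst frac_eq_eq) auto
  then have "quotient1 k a = 2 * ((1 - L - a + k * (1 - a)) / (1 - L + k * (1 + L)))"
    using quotient1_pos_k[OF assms(1), of a] by (metis times_divide_eq_right)
  also have "\<dots> = quotient2 k L a"
    using a by (simp add: quotient2_def max_absorb2)
  finally show ?thesis
    by (simp add: a_def)
qed

section \<open>Minimality of \<open>a0\<close> and the closed form for \<open>L = 0\<close>\<close>

lemma bound_fun_zero_k:
  assumes "0 \<le> L" "L < 1" "a \<in> {0..1 - L}"
  shows "bound_fun 0 L a = 2"
  \<comment> \<open>The first quotient is constantly 2, at \<open>a = 0\<close> by convention, and
    the second is at most 2 because both \<open>a\<close> and \<open>1 - L - a\<close> are at most
    \<open>1 - L\<close>.\<close>
  using assms by (simp add: bound_fun_def quotient1_zero_k quotient2_def max_def field_simps)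

lemma bound_fun_a0_le:
  assumes "0 \<le> k" "k < 1" "0 \<le> L" "L < 1" "a \<in> {0..1 - L}"
  shows "bound_fun k L (a0 k L) \<le> bound_fun k L a"
proof (cases "k = 0")
  case True
  then have "a0 k L \<in> {0..1 - L}"
    using assms by (simp add: a0_def)
  then show ?thesis
    using assms True bound_fun_zero_k by simp
next
  case False
  then have k: "0 < k"
    using assms by simp
  show ?thesis
  \<comment> \<open>Right of \<open>a0\<close> the first quotient is at least the common value at
    \<open>a0\<close>; left of it the second one is.\<close>
  proof (cases "a0 k L \<le> a")
    case True
    then show ?thesis
      using quotient1_mono[of k "a0 k L" a] a0_nonneg[of k L] quotients_agree_at_a0[of k L] k assms
      by (simp add: bound_fun_def)
  next
    case False
    then show ?thesis
      using quotient2_antimono[of k L a "a0 k L"] a0_le_half[of k L]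
        quotients_agree_at_a0[of k L] k assms
      by (simp add: bound_fun_def)
  qed
qed

lemma a0_mem:
  assumes "0 \<le> k" "k < 1" "0 \<le> L" "L < 1"
  shows "a0 k L \<in> {0..1 - L}"
  using a0_nonneg[of k L] a0_le_half[of k L] assms by simp

lemma g_m_eq:
  assumes "0 \<le> k" "k < 1" "0 \<le> L" "L < 1"
  shows "g_m k L = bound_fun k L (a0 k L)"
  unfolding g_m_def using a0_mem bound_fun_a0_le assms
  by (intro cInf_eq_minimum) auto

lemma g_m_no_obstacle:
  assumes "0 \<le> k" "k < 1"
  shows "g_m k 0 = 2 / (1 + sqrt k)"
proof (cases "k = 0")
  case True
  then show ?thesis
    using g_m_eq[of 0 0] a0_mem[of 0 0] bound_fun_zero_k[of 0 "a0 0 0"] by simp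
next
  case False
  define s where "s = sqrt k"
  have s: "0 < s" "s < 1" and k: "k = s\<^sup>2"
    using False assms by (auto simp: s_def)
  \<comment> \<open>For \<open>L = 0\<close> the discriminant is a perfect square in
    \<open>s\<close>: it equals \<open>4 * (1 + k)\<^sup>2 * k * (k + (1 - k))\<close>.\<close>
  have "(k * (2 * (1 + k)))\<^sup>2 + 4 * (1 + k) * (1 - k) * k * (1 + k) = (2 * (1 + k) * s)\<^sup>2"
    by (simp add: k power2_eq_square algebra_simps)
  then have "sqrt (k\<^sup>2 * (2 * (1 + k))\<^sup>2 + 4 * (1 + k) * (1 - k) * k * (1 + k)) = 2 * (1 + k) * s"
    using s assms by (simp add: power_mult_distrib[symmetric])
  then have "a0 k 0 = (2 * (1 + k) * (s - k)) / (2 * (1 + k) * (1 - k))"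
    by (simp add: a0_def algebra_simps)
  also have "\<dots> = (s - k) / (1 - k)"
    using assms by simp
  finally have "(1 - k) * a0 k 0 = s - k"
    using assms by simp
  then have "quotient1 k (a0 k 0) = 2 * s / (k + s)"
    using assms False by (simp add: quotient1_pos_k)
  also have "\<dots> = 2 / (1 + s)"
  proof -
    have "0 < s + s * s"
      using s by (simp add: add_pos_pos)
    then show ?thesis
      using s by (simp add: k power2_eq_square field_simps)
  qed
  finally show ?thesis
    using g_m_eq[of k 0] quotients_agree_at_a0[of k 0] assms False
    by (simp add: bound_fun_def s_def)
qed

section \<open>Profiles with two agents left of the obstacle\<close>

text \<open>Moving \<open>b\<close> to 1 trades walking at rate 1 for travel on the edge at rate
  \<open>k\<close>, saving \<open>(1 - k) * (1 - b)\<close>. This removes \<open>b\<close> from the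
  lower bounds.\<close>

lemma cost_left_ge:
  assumes "k \<le> 1" "b \<le> 1" "x < p"
  shows "\<bar>x - a\<bar> + k * (1 - a) \<le> cost k p (a, b) x"
proof -
  have "0 \<le> (1 - k) * (1 - b)"
    using assms by simp
  then show ?thesis
    using assms by (simp add: cost_def algebra_simps)
qed

lemma cost_nonneg:
  assumes "0 \<le> k" "0 \<le> L" "e \<in> edges L p"
  shows "0 \<le> cost k p e x"
proof (cases e)
  case (Pair a b)
  then have "0 \<le> a" "a \<le> b" "b \<le> 1"
    using assms by (auto simp: edges_def left_region_def right_region_def)
  then show ?thesis
    using assms Pair by (auto simp: cost_def intro!: add_nonneg_nonneg)
qed

lemma opt_MC_le:
  assumes "0 \<le> k" "0 \<le> L" "xs \<noteq> []" "e \<in> edges L p"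
  shows "opt_MC k L p xs \<le> MC k p e xs"
proof -
  \<comment> \<open>The real infimum lies below each value only for a set bounded below; nonnegative
    costs supply the bound.\<close>
  have "0 \<le> MC k p e' xs" if "e' \<in> edges L p" for e'
  proof -
    have "0 \<le> cost k p e' (hd xs)"
      using cost_nonneg assms that by blast
    also have "\<dots> \<le> MC k p e' xs"
      unfolding MC_def using assms by (intro Max_ge) auto
    finally show ?thesis .
  qed
  then have "bdd_below ((\<lambda>e. MC k p e xs) ` edges L p)"
    by (intro bdd_belowI[of _ 0]) auto
  then show ?thesis
    unfolding opt_MC_def using assms by (intro cINF_lower) auto
qed

lemma opt_MC_pair_le:
  assumes "0 \<le> k" "0 \<le> L" "obstacle_pos L p" "0 \<le> y" "y < p"
  shows "opt_MC k L p [0, y] \<le> y / 2 + k * (1 - y / 2)"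
proof -
  \<comment> \<open>The edge from the midpoint of the two agents gives both the same cost.\<close>
  have "(y / 2, 1) \<in> edges L p"
    using assms by (auto simp: edges_def left_region_def right_region_def obstacle_pos_def)
  then have "opt_MC k L p [0, y] \<le> MC k p (y / 2, 1) [0, y]"
    using assms by (intro opt_MC_le) auto
  also have "\<dots> = y / 2 + k * (1 - y / 2)"
    using assms by (simp add: MC_def cost_def)
  finally show ?thesis .
qed

lemma approx_ratio_pair:
  assumes "0 \<le> k" "k < 1" "0 \<le> L" "is_mechanism L f" "approx_ratio k L f \<alpha>"
    and "obstacle_pos L p" "0 \<le> y" "y < p" "f p [0, y] = (a, b)"
  shows "max a (y - a) + k * (1 - a) \<le> \<alpha> * (y / 2 + k * (1 - y / 2))"
proof -
  have prof: "profile L p [0, y]"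
    using assms by (auto simp: profile_def left_region_def)
  then have "(a, b) \<in> edges L p"
    using assms by (metis is_mechanism_def)
  then have b: "b \<le> 1"
    by (simp add: edges_def right_region_def)
  have "\<bar>0 - a\<bar> + k * (1 - a) \<le> cost k p (a, b) 0" "\<bar>y - a\<bar> + k * (1 - a) \<le> cost k p (a, b) y"
    using assms b by (intro cost_left_ge; auto)+
  moreover have "cost k p (a, b) 0 \<le> MC k p (a, b) [0, y]" "cost k p (a, b) y \<le> MC k p (a, b) [0, y]"
    by (auto simp: MC_def)
  ultimately have "max a (y - a) + k * (1 - a) \<le> MC k p (f p [0, y]) [0, y]"
    using assms by auto
  also have "\<dots> \<le> \<alpha> * opt_MC k L p [0, y]"
    using assms(5,6) prof unfolding approx_ratio_def by blast
  also have "\<dots> \<le> \<alpha> * (y / 2 + k * (1 - y / 2))"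
    using assms opt_MC_pair_le by (intro mult_left_mono) (auto simp: approx_ratio_def)
  finally show ?thesis .
qed

text \<open>In \<open>[0, a]\<close> the agent at \<open>a\<close> can report \<open>y\<close> and
  obtain an edge starting at its own location. Truth must be no worse, and the slack comes only from
  \<open>1 - b\<close>, which is below \<open>1 - L - p\<close>.\<close>

lemma strategyproof_stable:
  assumes "0 \<le> k" "k < 1" "is_mechanism L f" "strategyproof k L f"
    and "obstacle_pos L p" "0 \<le> y" "y < p"
    and "f p [0, y] = (a, b)" "f p [0, a] = (a', b')"
  shows "\<bar>a - a'\<bar> \<le> 1 - L - p"
proof -
  have "profile L p [0, y]"
    using assms by (auto simp: profile_def left_region_def)
  then have "(a, b) \<in> edges L p"
    using assms by (metis is_mechanism_def)
  then have ab: "0 \<le> a" "a < p" "p + L < b"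
    by (auto simp: edges_def left_region_def right_region_def)
  then have prof: "profile L p [0, a]"
    by (auto simp: profile_def left_region_def)
  then have "(a', b') \<in> edges L p"
    using assms by (metis is_mechanism_def)
  then have b': "b' \<le> 1"
    by (simp add: edges_def right_region_def)
  have "cost k p (f p [0, a]) ([0, a] ! 1) \<le> cost k p (f p ([0, a][1 := y])) ([0, a] ! 1)"
    using assms(4)[unfolded strategyproof_def, rule_format, of p "[0, a]" 1 y] assms prof ab
    by (simp add: same_region_def left_region_def)
  then have "\<bar>a - a'\<bar> + k * (1 - a') \<le> cost k p (a, b) a"
    using cost_left_ge[of k b' a p a'] assms ab b' by simp
  also have "\<dots> = k * (1 - a) + (1 - k) * (1 - b)"
    using ab by (simp add: cost_def algebra_simps)
  also have "\<dots> \<le> k * (1 - a) + (1 - k) * (1 - L - p)"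
    using ab assms by (intro add_left_mono mult_left_mono) auto
  finally have "\<bar>a - a'\<bar> - k * (a' - a) \<le> (1 - k) * (1 - L - p)"
    by (simp add: algebra_simps)
  \<comment> \<open>A start further right shortens the edge, but this recovers only a fraction
    \<open>k\<close> of the displacement, so the factor \<open>1 - k\<close> cancels below.\<close>
  moreover have "k * (a' - a) \<le> k * \<bar>a - a'\<bar>"
    using assms by (intro mult_left_mono) auto
  ultimately have "(1 - k) * \<bar>a - a'\<bar> \<le> (1 - k) * (1 - L - p)"
    by (simp add: algebra_simps)
  then show ?thesis
    using assms by simp
qed

text \<open>
  The distance \<open>\<delta>\<close> between the obstacle and the right end is arbitrarily small, so both
  inequalities hold up to an arbitrarily small error.
\<close>

lemma approx_ratio_bounds:
  assumes "0 \<le> k" "k < 1" "0 \<le> L" "L < 1"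
    and f: "is_mechanism L f" "strategyproof k L f" "approx_ratio k L f \<alpha>"
    and \<delta>: "0 < \<delta>" "\<delta> < (1 - L) / 2"
  obtains a where "a \<in> {0..1 - L}"
    "2 * (max a (1 - L - a) + k * (1 - a)) \<le> \<alpha> * (1 - L + k * (1 + L)) + 4 * \<delta>"
    "a + k * (1 - a) \<le> \<alpha> * (a / 2 + k * (1 - a / 2)) + \<delta>"
proof -
  \<comment> \<open>The region right of the obstacle gets length \<open>\<delta>\<close>, and
    \<open>y\<close> lies \<open>\<delta>\<close> left of the obstacle;
    \<open>\<delta> < (1 - L) / 2\<close> keeps \<open>y\<close> positive.\<close>
  define p where "p = 1 - L - \<delta>"
  define y where "y = 1 - L - 2 * \<delta>"
  have p: "obstacle_pos L p" and y: "0 \<le> y" "y < p"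
    using assms by (auto simp: obstacle_pos_def p_def y_def)
  have \<alpha>: "1 \<le> \<alpha>"
    using f by (simp add: approx_ratio_def)
  obtain a b where ab: "f p [0, y] = (a, b)"
    by fastforce
  obtain a' b' where ab': "f p [0, a] = (a', b')"
    by fastforce
  have "profile L p [0, y]"
    using y by (auto simp: profile_def left_region_def)
  then have "(a, b) \<in> edges L p"
    using f p ab by (metis is_mechanism_def)
  then have a: "0 \<le> a" "a < p"
    by (auto simp: edges_def left_region_def)
  have "max a (y - a) + k * (1 - a) \<le> \<alpha> * (y / 2 + k * (1 - y / 2))"
    using approx_ratio_pair[OF _ _ _ f(1,3) p y ab] assms by simp
  also have "\<dots> = \<alpha> * ((1 - L + k * (1 + L)) / 2) - \<alpha> * ((1 - k) * \<delta>)"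
    by (simp add: y_def field_simps)
  also have "\<dots> \<le> \<alpha> * ((1 - L + k * (1 + L)) / 2)"
    using \<alpha> assms by simp
  finally have "2 * (max a (y - a) + k * (1 - a)) + 4 * \<delta> \<le> \<alpha> * (1 - L + k * (1 + L)) + 4 * \<delta>"
    by simp
  moreover have "max a (1 - L - a) \<le> max a (y - a) + 2 * \<delta>"
    using \<delta> by (simp add: y_def max_def)
  then have "2 * (max a (1 - L - a) + k * (1 - a)) \<le> 2 * (max a (y - a) + k * (1 - a)) + 4 * \<delta>"
    by (simp del: max.bounded_iff)
  ultimately have 1: "2 * (max a (1 - L - a) + k * (1 - a)) \<le> \<alpha> * (1 - L + k * (1 + L)) + 4 * \<delta>"
    by (rule order_trans[rotated])
  \<comment> \<open>Now the profile is \<open>[0, a]\<close>: replacing \<open>a'\<close> by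
    \<open>a\<close> in \<open>a' + k * (1 - a')\<close> adds \<open>(1 - k) * (a - a')\<close>, at
    most \<open>\<delta>\<close>.\<close>
  have "a - a' \<le> \<delta>"
    using strategyproof_stable[OF _ _ f(1,2) p y ab ab'] assms by (simp add: p_def)
  then have "(1 - k) * (a - a') \<le> (1 - k) * \<delta>"
    using assms by (intro mult_left_mono) auto
  also have "\<dots> \<le> \<delta>"
    using assms by (simp add: algebra_simps)
  finally have "a + k * (1 - a) \<le> max a' (a - a') + k * (1 - a') + \<delta>"
    by (simp add: algebra_simps max_def)
  also have "max a' (a - a') + k * (1 - a') \<le> \<alpha> * (a / 2 + k * (1 - a / 2))"
    using approx_ratio_pair[OF _ _ _ f(1,3) p a ab'] assms by simp
  finally have 2: "a + k * (1 - a) \<le> \<alpha> * (a / 2 + k * (1 - a / 2)) + \<delta>"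
    by simp
  show thesis
    using that[of a] a 1 2 \<delta> by (simp add: p_def)
qed

text \<open>In place of a limit, one \<open>\<delta>\<close> chosen small against the gap
  \<open>\<epsilon>\<close> puts both quotients at some \<open>a\<close> strictly below
  \<open>g_m\<close>, contradicting minimality.\<close>

lemma g_m_le_approx_ratio:
  assumes "0 \<le> k" "k < 1" "0 \<le> L" "L < 1"
    and f: "is_mechanism L f" "strategyproof k L f" "approx_ratio k L f \<alpha>"
  shows "g_m k L \<le> \<alpha>"
proof (rule ccontr)
  assume "\<not> g_m k L \<le> \<alpha>"
  define \<epsilon> where "\<epsilon> = g_m k L - \<alpha>"
  define D where "D = 1 - L + k * (1 + L)"
  have \<epsilon>: "0 < \<epsilon>"
    using \<open>\<not> g_m k L \<le> \<alpha>\<close> by (simp add: \<epsilon>_def)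
  have D: "0 < D"
    unfolding D_def using quotient2_denom_pos assms by blast
  \<comment> \<open>For \<open>k = 0\<close> the denominator of the first quotient is only bounded below by \<open>c\<close> because
      the second inequality keeps \<open>a\<close> away from \<open>0\<close>.\<close>
  define c where "c = (if k = 0 then (1 - L) * \<epsilon> / 8 else k)"
  have c: "0 < c"
    using \<epsilon> assms by (auto simp: c_def)
  \<comment> \<open>The three bounds make \<open>\<delta>\<close> admissible, give
    \<open>4 * \<delta> < \<epsilon> * D\<close> for the second quotient, and give
    \<open>\<delta> < c * \<epsilon>\<close> for the first.\<close>
  define \<delta> where "\<delta> = min ((1 - L) / 4) (min (\<epsilon> * D / 8) (c * \<epsilon> / 2))"
  have "0 < \<delta>"
    using \<epsilon> D c assms by (simp add: \<delta>_def)
  moreover have "\<delta> \<le> (1 - L) / 4" "\<delta> \<le> \<epsilon> * D / 8" "\<delta> \<le> c * \<epsilon> / 2"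
    unfolding \<delta>_def by linarith+
  ultimately have \<delta>: "0 < \<delta>" "\<delta> \<le> (1 - L) / 4" "\<delta> \<le> \<epsilon> * D / 8" "\<delta> \<le> c * \<epsilon> / 2"
    by auto
  obtain a where a: "a \<in> {0..1 - L}"
    and 2: "2 * (max a (1 - L - a) + k * (1 - a)) \<le> \<alpha> * D + 4 * \<delta>"
    and 1: "a + k * (1 - a) \<le> \<alpha> * (a / 2 + k * (1 - a / 2)) + \<delta>"
    using approx_ratio_bounds[OF assms(1-4) f, of \<delta>] \<delta> assms unfolding D_def by auto
  have "\<alpha> * D + 4 * \<delta> < g_m k L * D"
  proof -
    have "0 < \<epsilon> * D"
      using \<epsilon> D by simp
    then have "4 * \<delta> < \<epsilon> * D"
      using \<delta> by linarith
    then show ?thesis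
      by (simp add: \<epsilon>_def algebra_simps)
  qed
  with 2 have q2: "quotient2 k L a < g_m k L"
    using D by (simp add: quotient2_def pos_divide_less_eq flip: D_def)
  define E where "E = a / 2 + k * (1 - a / 2)"
  have den: "c \<le> E"
  proof (cases "k = 0")
    case True
    then have g: "g_m k L = 2"
      using g_m_eq a0_mem bound_fun_zero_k assms by metis
    \<comment> \<open>Here \<open>D = 1 - L\<close> and \<open>\<alpha> = 2 - \<epsilon>\<close>, so
      the inequality forces \<open>a\<close> to be at least \<open>\<epsilon> * (1 - L) / 4\<close>,
      that is \<open>2 * c\<close>.\<close>
    have "2 * (1 - L - a) \<le> \<alpha> * (1 - L) + 4 * \<delta>"
      using 2 True by (simp add: D_def max_def split: if_splits)
    moreover have "8 * \<delta> \<le> \<epsilon> * (1 - L)"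
      using \<delta> True by (simp add: D_def)
    ultimately have "\<epsilon> * (1 - L) \<le> 4 * a"
      using g by (simp add: \<epsilon>_def algebra_simps)
    then show ?thesis
      using True by (simp add: c_def E_def algebra_simps)
  next
    case False
    have "0 \<le> (1 - k) * a"
      using assms a by simp
    then show ?thesis
      using False by (simp add: c_def E_def algebra_simps)
  qed
  have "c * \<epsilon> \<le> \<epsilon> * E" "0 < c * \<epsilon>"
    using den \<epsilon> c by auto
  then have "\<delta> < \<epsilon> * E"
    using \<delta>(4) by linarith
  then have "a + k * (1 - a) < g_m k L * E"
    using 1 unfolding \<epsilon>_def E_def[symmetric] left_diff_distrib by linarith
  then have "(a + k * (1 - a)) / E < g_m k L"
    using den c by (subst pos_divide_less_eq) auto
  \<comment> \<open>Positivity of \<open>E\<close> excludes the exceptional case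
    \<open>k = a = 0\<close> of \<open>quotient1\<close>.\<close>
  then have "quotient1 k a < g_m k L"
    using den c by (auto simp: quotient1_def E_def)
  with q2 have "bound_fun k L a < g_m k L"
    by (simp add: bound_fun_def)
  then show False
    using bound_fun_a0_le[OF assms(1-4) a] g_m_eq[OF assms(1-4)] by simp
qed

theorem theorem5:
  fixes k L :: real
  assumes "0 \<le> k" "k < 1" and "0 \<le> L" "L < 1"
  shows "\<not> (\<exists>f \<alpha>. is_mechanism L f \<and> anonymous L f \<and> strategyproof k L f \<and>
               approx_ratio k L f \<alpha> \<and> \<alpha> < g_m k L)
    \<and> is_arg_min (bound_fun k L) (\<lambda>a. a \<in> {0..1 - L}) (a0 k L)
    \<and> g_m k L = bound_fun k L (a0 k L)
    \<and> (L = 0 \<longrightarrow> g_m k L = 2 / (1 + sqrt k))"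
proof (intro conjI impI)
  show "\<not> (\<exists>f \<alpha>. is_mechanism L f \<and> anonymous L f \<and> strategyproof k L f \<and>
      approx_ratio k L f \<alpha> \<and> \<alpha> < g_m k L)"
    using g_m_le_approx_ratio[OF assms] by (meson not_less)
  show "is_arg_min (bound_fun k L) (\<lambda>a. a \<in> {0..1 - L}) (a0 k L)"
    using a0_mem[OF assms] bound_fun_a0_le[OF assms] by (auto simp: is_arg_min_def not_less)
  show "g_m k L = bound_fun k L (a0 k L)"
    using g_m_eq[OF assms] .
  show "g_m k L = 2 / (1 + sqrt k)" if "L = 0"
    using g_m_no_obstacle that assms by simp
qed

end
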